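(* Let $\mathcal{L}\in\{\mathrm{ML},\mathrm{ML}(\underline{\vee}),\mathrm{MDL},\mathrm{EMDL}\}$ and let $\varphi$ be an $\mathcal{L}$-formula. Every tableau for $\varphi$ in $\mathbf{T}_{\mathcal{L}}$ is finite.
   Context: Syntax (negation normal form): $\mathrm{ML}$: $\varphi::=p\mid\neg p\mid(\varphi\wedge\varphi)\mid(\varphi\vee\varphi)\mid\Diamond\varphi\mid\Box\varphi$; $\mathrm{ML}(\underline{\vee})$ adds intuitionistic disjunction $(\varphi\,\underline{\vee}\,\varphi)$; $\mathrm{MDL}$ adds atoms ${=}(p_1,\dots,p_n,q)$ (proposition symbols); $\mathrm{EMDL}$ adds atoms ${=}(\varphi_1,\dots,\varphi_n,\psi)$ with $\varphi_i,\psi\in\mathrm{ML}$. For $\chi\in\mathrm{ML}$, $\chi^\bot$ is the negation normal form of $\neg\chi$ (swap $p/\neg p$, $\wedge/\vee$, $\Diamond/\Box$) and $\chi^\top:=\chi$. $\mathrm{vrank}(\varphi)$ is the number of $\underline{\vee}$ in $\varphi$, where each dependence atom ${=}(\varphi_1,\dots,\varphi_n,\psi)$ is first replaced by $\bigvee_{\vec a\in\{\bot,\top\}^n}\bigwedge\{\varphi_1^{a_1},\dots,\varphi_n^{a_n},(\psi\,\underline{\vee}\,\psi^\bot)\}$. Labeled tableaux: labels are finite subsets of $\mathbb{N}$; nodes carry labeled formulas $\alpha:\varphi$ or accessibility formulas $i\mathsf{R}j$ ($i,j\in\mathbb{N}$). A tableau is a finitely branching tree built from the root by rule applications; a rule extends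 a branch containing its premises by alternatives (separated by $\mid$), each adding all its listed items; a labeled formula is never added to a branch already containing it, and rule ($\Box$) is never applied twice to the same labeled formula on a branch. Rules: (Prop) from $\{i_1,\dots,i_k\}:p$: $\{i_1\}:p\mid\dots\mid\{i_k\}:p$; ($\neg$Prop) likewise for $\neg p$; ($\wedge$) from $\alpha:(\varphi\wedge\psi)$: $\alpha:\varphi\mid\alpha:\psi$; ($\vee$) from $\alpha:(\varphi\vee\psi)$ and any $\beta\subseteq\alpha$: $\beta:\varphi\mid\alpha\setminus\beta:\psi$; ($\underline{\vee}$) from $\alpha:(\varphi\,\underline{\vee}\,\psi)$: add $\alpha:\varphi$ and $\alpha:\psi$; (Split) from $\alpha:{=}(\vec\chi,\theta)$: $\alpha_1:{=}(\vec\chi,\theta)\mid\dots\mid\alpha_k:{=}(\vec\chi,\theta)$ with $\alpha_1,\dots,\alpha_k$ all 2-element subsets of $\alpha$; (PL dep) from $\{i_1,i_2\}:{=}(p_1,\dots,p_n,q)$: one alternative per $g:\{1,\dots,n\}\to\{\top,\bot\}$ adding $\{i_1\}:p_m^{g(m)},\{i_2\}:p_m^{g(m)}$ ($m\le n$), $\{i_1,i_2\}:q$, $\{i_1,i_2\}:\neg q$; (ML dep) from $\{i_1,i_2\}:{=}(\varphi_1,\dots,\varphi_n,\psi)$: one alternative per $h:\{1,\dots,n\}\to\{\top,\bot\}$ adding $\{i_1\}:\varphi_m^{h(m)},\{i_2\}:\varphi_m^{h(m)}$ ($m\le n$), $\{i_1,i_2\}:\psi$, $\{i_1,i_2\}:\psi^\bot$;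 ($\Diamond$) from $\{i_1,\dots,i_n\}:\Diamond\varphi$ and $i_1\mathsf{R}j_1,\dots,i_n\mathsf{R}j_n$ on the branch: add $\{j_1,\dots,j_n\}:\varphi$; ($\Box$) from $\alpha:\Box\varphi$: let $t=2^{\mathrm{vrank}(\varphi)}$ and $i_1,\dots,i_t$ fresh distinct numbers; one alternative for each function $f:\{1,\dots,t\}\to\alpha$, adding $f(1)\mathsf{R}i_1,\dots,f(t)\mathsf{R}i_t$ and $\{i_1,\dots,i_t\}:\varphi$. Calculi: $\mathbf{T}_{\mathrm{ML}}$ = (Prop),($\neg$Prop),($\wedge$),($\vee$),($\Diamond$),($\Box$); $\mathbf{T}_{\mathrm{ML}(\underline{\vee})}$ = $\mathbf{T}_{\mathrm{ML}}$ + ($\underline{\vee}$); $\mathbf{T}_{\mathrm{MDL}}$ = $\mathbf{T}_{\mathrm{ML}}$ + (Split) + (PL dep); $\mathbf{T}_{\mathrm{EMDL}}$ = $\mathbf{T}_{\mathrm{ML}}$ + (Split) + (ML dep). A tableau for $\varphi$ in $\mathbf{T}_{\mathcal{L}}$ has root $\{1,\dots,2^{\mathrm{vrank}(\varphi)}\}:\varphi$ and uses rules of $\mathbf{T}_{\mathcal{L}}$. *)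

theory Defs
  imports Main
begin

section \<open>Formulas\<close>

text \<open>One datatype covers the formulas of all four logics; \<open>formula\<close> below carves out each of them.
  \<open>Dep [\<phi>\<^sub>1,\<dots>,\<phi>\<^sub>n] \<psi>\<close> is the dependence atom \<open>=(\<phi>\<^sub>1,\<dots>,\<phi>\<^sub>n,\<psi>)\<close> (with \<open>n = 0\<close> allowed), and
  \<open>IOr\<close> is intuitionistic disjunction.\<close>

datatype 'p fm =
    Prop 'p
  | NProp 'p
  | And "'p fm" "'p fm"
  | Or "'p fm" "'p fm"
  | IOr "'p fm" "'p fm"
  | Dia "'p fm"
  | Box "'p fm"
  | Dep "'p fm list" "'p fm"

datatype logic = MLog | MLog_IOr | MDL | EMDL

fun formula :: "logic \<Rightarrow> 'p fm \<Rightarrow> bool" where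
  "formula L (Prop p) = True"
| "formula L (NProp p) = True"
| "formula L (And \<phi> \<psi>) = (formula L \<phi> \<and> formula L \<psi>)"
| "formula L (Or \<phi> \<psi>) = (formula L \<phi> \<and> formula L \<psi>)"
| "formula L (IOr \<phi> \<psi>) = (L = MLog_IOr \<and> formula L \<phi> \<and> formula L \<psi>)"
| "formula L (Dia \<phi>) = formula L \<phi>"
| "formula L (Box \<phi>) = formula L \<phi>"
| "formula L (Dep \<phi>s \<psi>) =
    ((L = MDL \<and> (\<forall>\<chi>\<in>set \<phi>s. \<exists>p. \<chi> = Prop p) \<and> (\<exists>q. \<psi> = Prop q)) \<or>
     (L = EMDL \<and> (\<forall>\<chi>\<in>set \<phi>s. formula MLog \<chi>) \<and> formula MLog \<psi>))"

text \<open>The negation \<open>\<chi>\<^sup>\<bottom>\<close>; deliberately left unspecified outside modal logic (on \<open>IOr\<close> and \<open>Dep\<close>).\<close>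

fun neg :: "'p fm \<Rightarrow> 'p fm" where
  "neg (Prop p) = NProp p"
| "neg (NProp p) = Prop p"
| "neg (And \<phi> \<psi>) = Or (neg \<phi>) (neg \<psi>)"
| "neg (Or \<phi> \<psi>) = And (neg \<phi>) (neg \<psi>)"
| "neg (Dia \<phi>) = Box (neg \<phi>)"
| "neg (Box \<phi>) = Dia (neg \<phi>)"

definition signed :: "'p fm \<Rightarrow> bool \<Rightarrow> 'p fm" where
  "signed \<chi> a = (if a then \<chi> else neg \<chi>)"

text \<open>All vectors in \<open>{\<bottom>,\<top>}\<^sup>n\<close>.\<close>

definition signs :: "nat \<Rightarrow> bool list list" where
  "signs n = List.n_lists n [False, True]"

text \<open>Only used for nonempty lists.\<close>

fun Conj :: "'p fm list \<Rightarrow> 'p fm" where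
  "Conj [\<phi>] = \<phi>"
| "Conj (\<phi> # \<psi> # \<phi>s) = And \<phi> (Conj (\<psi> # \<phi>s))"

fun Disj :: "'p fm list \<Rightarrow> 'p fm" where
  "Disj [\<phi>] = \<phi>"
| "Disj (\<phi> # \<psi> # \<phi>s) = Or \<phi> (Disj (\<psi> # \<phi>s))"

primrec elim_dep :: "'p fm \<Rightarrow> 'p fm" where
  "elim_dep (Prop p) = Prop p"
| "elim_dep (NProp p) = NProp p"
| "elim_dep (And \<phi> \<psi>) = And (elim_dep \<phi>) (elim_dep \<psi>)"
| "elim_dep (Or \<phi> \<psi>) = Or (elim_dep \<phi>) (elim_dep \<psi>)"
| "elim_dep (IOr \<phi> \<psi>) = IOr (elim_dep \<phi>) (elim_dep \<psi>)"
| "elim_dep (Dia \<phi>) = Dia (elim_dep \<phi>)"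
| "elim_dep (Box \<phi>) = Box (elim_dep \<phi>)"
| "elim_dep (Dep \<phi>s \<psi>) =
    Disj (map (\<lambda>a. Conj (map2 signed \<phi>s a @ [IOr \<psi> (neg \<psi>)])) (signs (length \<phi>s)))"

text \<open>The value on \<open>Dep\<close> is irrelevant: \<open>elim_dep\<close> leaves no dependence atoms.\<close>

primrec count_IOr :: "'p fm \<Rightarrow> nat" where
  "count_IOr (Prop p) = 0"
| "count_IOr (NProp p) = 0"
| "count_IOr (And \<phi> \<psi>) = count_IOr \<phi> + count_IOr \<psi>"
| "count_IOr (Or \<phi> \<psi>) = count_IOr \<phi> + count_IOr \<psi>"
| "count_IOr (IOr \<phi> \<psi>) = Suc (count_IOr \<phi> + count_IOr \<psi>)"
| "count_IOr (Dia \<phi>) = count_IOr \<phi>"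
| "count_IOr (Box \<phi>) = count_IOr \<phi>"
| "count_IOr (Dep \<phi>s \<psi>) = 0"

definition vrank :: "'p fm \<Rightarrow> nat" where
  "vrank \<phi> = count_IOr (elim_dep \<phi>)"


section \<open>Tableau rules\<close>

text \<open>Labels are not restricted to finite sets by the type, but every label occurring in a
  tableau is finite because the root label is.\<close>

datatype 'p item =
    Lab "nat set" "'p fm"
  | Acc nat nat

primrec nums :: "'p item \<Rightarrow> nat set" where
  "nums (Lab \<alpha> \<phi>) = \<alpha>"
| "nums (Acc i j) = {i, j}"

text \<open>\<open>rule L B x alts\<close>: on a branch whose set of items is \<open>B\<close>, the calculus for \<open>L\<close> has a rule
  instance with principal formula \<open>x\<close> and alternatives \<open>alts\<close>, each alternative being the list of
  its items.  That \<open>x\<close> lies on the branch is required in \<open>expansion\<close> below; \<open>B\<close> is needed here for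
  the accessibility premises of \<open>Dia\<close> and the freshness condition of \<open>Box\<close>.  The enumerations \<open>is\<close>
  and \<open>\<beta>s\<close> only serve to list the alternatives.\<close>

inductive rule :: "logic \<Rightarrow> 'p item set \<Rightarrow> 'p item \<Rightarrow> 'p item list list \<Rightarrow> bool"
  for L :: logic and B :: "'p item set" where
  Prop: "distinct is \<Longrightarrow>
    rule L B (Lab (set is) (Prop p)) (map (\<lambda>i. [Lab {i} (Prop p)]) is)"
| NProp: "distinct is \<Longrightarrow>
    rule L B (Lab (set is) (NProp p)) (map (\<lambda>i. [Lab {i} (NProp p)]) is)"
| And: "rule L B (Lab \<alpha> (And \<phi> \<psi>)) [[Lab \<alpha> \<phi>], [Lab \<alpha> \<psi>]]"
| Or: "\<beta> \<subseteq> \<alpha> \<Longrightarrow>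
    rule L B (Lab \<alpha> (Or \<phi> \<psi>)) [[Lab \<beta> \<phi>], [Lab (\<alpha> - \<beta>) \<psi>]]"
| Dia: "(\<forall>i\<in>\<alpha>. Acc i (j i) \<in> B) \<Longrightarrow>
    rule L B (Lab \<alpha> (Dia \<phi>)) [[Lab (j ` \<alpha>) \<phi>]]"
| Box: "distinct is \<Longrightarrow> length js = 2 ^ vrank \<phi> \<Longrightarrow> distinct js \<Longrightarrow>
      set js \<inter> (\<Union>y\<in>B. nums y) = {} \<Longrightarrow>
    rule L B (Lab (set is) (Box \<phi>))
      (map (\<lambda>f. map2 Acc f js @ [Lab (set js) \<phi>]) (List.n_lists (length js) is))"
| IOr: "L = MLog_IOr \<Longrightarrow>
    rule L B (Lab \<alpha> (IOr \<phi> \<psi>)) [[Lab \<alpha> \<phi>, Lab \<alpha> \<psi>]]"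
| Split: "L = MDL \<or> L = EMDL \<Longrightarrow> distinct \<beta>s \<Longrightarrow> set \<beta>s = {\<beta>. \<beta> \<subseteq> \<alpha> \<and> card \<beta> = 2} \<Longrightarrow>
    rule L B (Lab \<alpha> (Dep \<phi>s \<psi>)) (map (\<lambda>\<beta>. [Lab \<beta> (Dep \<phi>s \<psi>)]) \<beta>s)"
| MDL_dep: "L = MDL \<Longrightarrow> i\<^sub>1 \<noteq> i\<^sub>2 \<Longrightarrow>
    rule L B (Lab {i\<^sub>1, i\<^sub>2} (Dep (map Prop ps) (Prop q)))
      (map (\<lambda>g. map2 (\<lambda>p a. Lab {i\<^sub>1} (signed (Prop p) a)) ps g
              @ map2 (\<lambda>p a. Lab {i\<^sub>2} (signed (Prop p) a)) ps g
              @ [Lab {i\<^sub>1, i\<^sub>2} (Prop q), Lab {i\<^sub>1, i\<^sub>2} (NProp q)])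
        (signs (length ps)))"
| EMDL_dep: "L = EMDL \<Longrightarrow> i\<^sub>1 \<noteq> i\<^sub>2 \<Longrightarrow>
    rule L B (Lab {i\<^sub>1, i\<^sub>2} (Dep \<phi>s \<psi>))
      (map (\<lambda>h. map2 (\<lambda>\<phi> a. Lab {i\<^sub>1} (signed \<phi> a)) \<phi>s h
              @ map2 (\<lambda>\<phi> a. Lab {i\<^sub>2} (signed \<phi> a)) \<phi>s h
              @ [Lab {i\<^sub>1, i\<^sub>2} \<psi>, Lab {i\<^sub>1, i\<^sub>2} (neg \<psi>)])
        (signs (length \<phi>s)))"


section \<open>Tableaux\<close>

text \<open>Finitely branching, possibly infinite trees.\<close>

codatatype 'a tree = Node (root: 'a) (children: "'a tree list")

primrec is_node :: "'a tree \<Rightarrow> nat list \<Rightarrow> bool" where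
  "is_node t [] = True"
| "is_node t (k # \<pi>) = (k < length (children t) \<and> is_node (children t ! k) \<pi>)"

definition finite_tree :: "'a tree \<Rightarrow> bool" where
  "finite_tree t \<longleftrightarrow> finite {\<pi>. is_node t \<pi>}"

text \<open>The items an alternative actually adds to a branch with items \<open>B\<close>: nothing is added that is
  already there.\<close>

definition new_items :: "'a set \<Rightarrow> 'a list \<Rightarrow> 'a list" where
  "new_items B alt = filter (\<lambda>x. x \<notin> B) (remdups alt)"

text \<open>A nonbranching sequence of nodes, ending in a node with children \<open>ts\<close>.\<close>

primrec chain :: "'a list \<Rightarrow> 'a tree list \<Rightarrow> 'a tree list" where
  "chain [] ts = ts"
| "chain (x # xs) ts = [Node x (chain xs ts)]"

text \<open>\<open>expansion L B D ts\<close>: the trees \<open>ts\<close> may appear below the end of a branch that carries the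
  items \<open>B\<close> and along which rules have been applied to the principal formulas \<open>D\<close>.  The branch may
  be left as it is or extended by a rule instance.  An instance may be used only if each of its
  alternatives adds something; an alternative adding nothing would have no node in the tree.
  Coinduction is what admits infinite tableaux.\<close>

coinductive expansion ::
  "logic \<Rightarrow> 'p item set \<Rightarrow> 'p item set \<Rightarrow> 'p item tree list \<Rightarrow> bool" for L :: logic where
  stop: "expansion L B D []"
| extend: "x \<in> B \<Longrightarrow> rule L B x alts \<Longrightarrow>
    (\<forall>\<alpha> \<phi>. x = Lab \<alpha> (Box \<phi>) \<longrightarrow> x \<notin> D) \<Longrightarrow>
    (\<forall>alt\<in>set alts. new_items B alt \<noteq> []) \<Longrightarrow>
    list_all2 (\<lambda>alt ts. expansion L (B \<union> set alt) (insert x D) ts) alts tss \<Longrightarrow>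
    expansion L B D (concat (map2 (\<lambda>alt ts. chain (new_items B alt) ts) alts tss))"
  monos list_all2_mono

definition tableau :: "logic \<Rightarrow> 'p fm \<Rightarrow> 'p item tree \<Rightarrow> bool" where
  "tableau L \<phi> t \<longleftrightarrow>
    root t = Lab {1..2 ^ vrank \<phi>} \<phi> \<and> expansion L {root t} {} (children t)"

end

(* Every number on a branch gets a depth, namely its distance from the root label, and every label
   consists of numbers of one depth n.  All rules preserve n + size \<chi> \<le> size \<phi> for the labeled
   formulas on the branch, so depths are bounded.  Along an infinite branch there are, by induction
   on n, only finitely many numbers of depth n: those of depth n + 1 are introduced by Box rules
   whose principal label has depth n, there are finitely many such principal formulas, and each is
   used at most once.  So the branch has finitely many items, yet each rule application adds one. *)

theory Submission imports Defs begin

section \<open>Component formulas\<close>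

text \<open>The formulas a rule can add besides the principal one. For \<open>Dep\<close> both signs
  occur, since the dependence rules may add either.\<close>

fun components :: "'p fm \<Rightarrow> 'p fm set" where
  "components (Prop p) = {}"
| "components (NProp p) = {}"
| "components (And \<phi> \<psi>) = {\<phi>, \<psi>}"
| "components (Or \<phi> \<psi>) = {\<phi>, \<psi>}"
| "components (IOr \<phi> \<psi>) = {\<phi>, \<psi>}"
| "components (Dia \<phi>) = {\<phi>}"
| "components (Box \<phi>) = {\<phi>}"
| "components (Dep \<phi>s \<psi>) = insert \<psi> (set \<phi>s) \<union> neg ` insert \<psi> (set \<phi>s)"

lemma finite_components: "finite (components \<phi>)"
  by (cases \<phi>) auto

lemma formula_MLog: "formula MLog \<phi> \<Longrightarrow> formula L \<phi>"
  by (induction \<phi>) auto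

lemma formula_neg: "formula MLog \<phi> \<Longrightarrow> formula L (neg \<phi>)"
  by (induction \<phi>) auto

lemma size_neg: "formula MLog \<phi> \<Longrightarrow> size (neg \<phi>) = size \<phi>"
  by (induction \<phi>) auto

lemma formula_components:
  assumes "formula L \<phi>" "\<psi> \<in> components \<phi>"
  shows "formula L \<psi>"
proof (cases \<phi>)
  case (Dep \<phi>s \<chi>)
  then have "\<forall>\<theta>\<in>insert \<chi> (set \<phi>s). formula MLog \<theta>"
    using assms(1) by auto
  then show ?thesis
    using assms(2) Dep by (auto intro: formula_MLog formula_neg)
qed (use assms in auto)

text \<open>Arguments of dependence atoms are purely modal; there negation only swaps connectives
  and keeps the size.\<close>

lemma size_components:
  assumes "formula L \<phi>" "\<psi> \<in> components \<phi>"
  shows "size \<psi> < size \<phi>"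
proof (cases \<phi>)
  case (Dep \<phi>s \<chi>)
  then have "\<forall>\<theta>\<in>insert \<chi> (set \<phi>s). formula MLog \<theta>"
    using assms(1) by auto
  moreover have "\<forall>\<theta>\<in>insert \<chi> (set \<phi>s). size \<theta> < size \<phi>"
    using Dep by (auto simp: less_Suc_eq_le intro: size_list_estimation' trans_le_add1)
  ultimately show ?thesis
    using assms(2) Dep by (auto simp: size_neg)
qed (use assms in auto)

text \<open>\<open>C\<close> will contain all formulas on all branches. The induction is on size,
  since a negated argument of a dependence atom need not be a subformula.\<close>

lemma finite_component_closure:
  "formula L \<phi> \<Longrightarrow> \<exists>C. finite C \<and> \<phi> \<in> C \<and> (\<forall>\<chi>\<in>C. formula L \<chi> \<and> components \<chi> \<subseteq> C)"
proof (induction \<phi> rule: measure_induct_rule[of size])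
  case (less \<phi>)
  have "\<forall>\<psi>\<in>components \<phi>. \<exists>C. finite C \<and> \<psi> \<in> C \<and> (\<forall>\<chi>\<in>C. formula L \<chi> \<and> components \<chi> \<subseteq> C)"
    using less.IH[OF size_components[OF less.prems] formula_components[OF less.prems]] by simp
  then obtain C where C: "\<forall>\<psi>\<in>components \<phi>. finite (C \<psi>) \<and> \<psi> \<in> C \<psi> \<and>
      (\<forall>\<chi>\<in>C \<psi>. formula L \<chi> \<and> components \<chi> \<subseteq> C \<psi>)"
    unfolding bchoice_iff ..
  show ?case
  proof (intro exI conjI ballI)
    let ?D = "insert \<phi> (\<Union>\<psi>\<in>components \<phi>. C \<psi>)"
    show "finite ?D"
      using C by (simp add: finite_components)
    show "\<phi> \<in> ?D" by simp
    show "formula L \<chi>" if "\<chi> \<in> ?D" for \<chi>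
      using that C less.prems by auto
    show "components \<chi> \<subseteq> ?D" if "\<chi> \<in> ?D" for \<chi>
      using that C by blast
  qed
qed

section \<open>Rule applications\<close>

lemma map2_signed:
  assumes "y \<in> set (map2 (\<lambda>\<phi> a. Lab \<alpha> (signed \<phi> a)) \<phi>s h)"
  obtains \<psi> where "y = Lab \<alpha> \<psi>" "\<psi> \<in> set \<phi>s \<union> neg ` set \<phi>s"
proof -
  obtain \<chi> a where "(\<chi>, a) \<in> set (zip \<phi>s h)" "y = Lab \<alpha> (signed \<chi> a)"
    using assms by auto
  then show ?thesis
    using that[of "signed \<chi> a"] by (auto simp: signed_def dest: set_zip_leftD)
qed

text \<open>Three kinds of rules, by their effect on numbers: local ones pass to subsets of the
  label, \<open>Dia\<close> follows existing edges, \<open>Box\<close> creates fresh successors. The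
  local kind admits the principal formula itself because \<open>Prop\<close>, \<open>NProp\<close>
  and \<open>Split\<close> repeat it.\<close>

lemma rule_cases_alt:
  assumes "rule L B x alts" "alt \<in> set alts"
  obtains
    (local) \<alpha> \<phi> where "x = Lab \<alpha> \<phi>"
      "\<And>y. y \<in> set alt \<Longrightarrow> \<exists>\<beta> \<psi>. y = Lab \<beta> \<psi> \<and> \<beta> \<subseteq> \<alpha> \<and> \<psi> \<in> insert \<phi> (components \<phi>)"
  | (dia) \<alpha> \<psi> \<beta> where "x = Lab \<alpha> (Dia \<psi>)" "alt = [Lab \<beta> \<psi>]" "\<forall>j\<in>\<beta>. \<exists>i\<in>\<alpha>. Acc i j \<in> B"
  | (box) \<alpha> \<psi> f js where "x = Lab \<alpha> (Box \<psi>)" "alt = map2 Acc f js @ [Lab (set js) \<psi>]"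
      "length f = length js" "set f \<subseteq> \<alpha>" "set js \<inter> (\<Union>y\<in>B. nums y) = {}"
  using assms(1)
proof cases
  case (Dia \<alpha> j \<phi>)
  then show ?thesis using assms(2) by (intro dia[of \<alpha> \<phi> "j ` \<alpha>"]) auto
next
  case (Box "is" js \<phi>)
  then obtain f where "f \<in> set (List.n_lists (length js) is)"
    "alt = map2 Acc f js @ [Lab (set js) \<phi>]"
    using assms(2) by auto
  then show ?thesis using Box by (intro box[of "set is" \<phi> f js]) (auto simp: set_n_lists)
next
  case (MDL_dep i1 i2 ps q)
  \<comment> \<open>Writing the arguments as \<open>map Prop ps\<close> and \<open>NProp q\<close>
    as \<open>neg (Prop q)\<close> gives the shape of the EMDL case.\<close>
  obtain g where g: "alt = map2 (\<lambda>p a. Lab {i1} (signed p a)) (map Prop ps) g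
      @ map2 (\<lambda>p a. Lab {i2} (signed p a)) (map Prop ps) g
      @ [Lab {i1, i2} (Prop q), Lab {i1, i2} (neg (Prop q))]"
    using assms(2) MDL_dep by (auto simp: zip_map1 case_prod_unfold comp_def)
  show ?thesis
    by (rule local[OF MDL_dep(1)]) (unfold g, auto elim!: map2_signed simp del: set_map)
next
  case (EMDL_dep i1 i2 \<phi>s \<psi>)
  then obtain g where g: "alt = map2 (\<lambda>p a. Lab {i1} (signed p a)) \<phi>s g
      @ map2 (\<lambda>p a. Lab {i2} (signed p a)) \<phi>s g
      @ [Lab {i1, i2} \<psi>, Lab {i1, i2} (neg \<psi>)]"
    using assms(2) by auto
  show ?thesis
    by (rule local[OF EMDL_dep(1)]) (unfold g, auto elim!: map2_signed simp del: set_map)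
qed (rule local, assumption, use assms(2) in fastforce)+

section \<open>Branches graded by depth, and the step relation between them\<close>

definition worlds :: "'p item set \<Rightarrow> nat set" where
  "worlds B = (\<Union>y\<in>B. nums y)"

text \<open>\<open>d\<close> is the depth function; \<open>size \<chi>\<close> is the reserve for
  further modal steps below a label of depth n. The depth is existentially quantified because an
  empty label does not determine one.\<close>

definition graded :: "'p fm set \<Rightarrow> nat \<Rightarrow> 'p item set \<Rightarrow> (nat \<Rightarrow> nat) \<Rightarrow> bool" where
  "graded C M B d \<longleftrightarrow> finite (worlds B) \<and> (\<forall>i\<in>worlds B. d i \<le> M) \<and>
    (\<forall>\<alpha> \<chi>. Lab \<alpha> \<chi> \<in> B \<longrightarrow> \<chi> \<in> C \<and> (\<exists>n. (\<forall>i\<in>\<alpha>. d i = n) \<and> n + size \<chi> \<le> M)) \<and>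
    (\<forall>i j. Acc i j \<in> B \<longrightarrow> d j = Suc (d i))"

type_synonym 'p state = "'p item set \<times> 'p item set \<times> (nat \<Rightarrow> nat)"

text \<open>The later state comes first, as \<open>wf\<close> expects. If numbers appear, one box
  formula first used in this step accounts for all of them, which is what allows them to be
  counted.\<close>

definition steps :: "'p fm set \<Rightarrow> nat \<Rightarrow> ('p state \<times> 'p state) set" where
  "steps C M = {((B', D', d'), (B, D, d)). graded C M B d \<and> B \<subset> B' \<and> D \<subseteq> D' \<and>
     (\<forall>i\<in>worlds B. d' i = d i) \<and>
     (worlds B' \<subseteq> worlds B \<or>
      (\<exists>\<alpha> \<phi>. Lab \<alpha> (Box \<phi>) \<in> B \<and> Lab \<alpha> (Box \<phi>) \<in> D' - D \<and>
         (\<forall>j\<in>worlds B' - worlds B. \<exists>i\<in>\<alpha>. d' j = Suc (d i))))}"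

lemma worlds_Un: "worlds (A \<union> B) = worlds A \<union> worlds B"
  by (auto simp: worlds_def)

lemma worlds_Lab: "Lab \<alpha> \<chi> \<in> B \<Longrightarrow> \<alpha> \<subseteq> worlds B"
  by (auto simp: worlds_def)

lemma worlds_Acc: "Acc i j \<in> B \<Longrightarrow> i \<in> worlds B \<and> j \<in> worlds B"
  by (force simp: worlds_def)

lemma worlds_mono: "A \<subseteq> B \<Longrightarrow> worlds A \<subseteq> worlds B"
  by (auto simp: worlds_def)

text \<open>Local rules keep the depth and do not enlarge the formula; \<open>Dia\<close> and
  \<open>Box\<close> trade the size of the operator for one unit of depth. Only \<open>Box\<close>
  changes \<open>d\<close>, at its fresh numbers.\<close>

lemma rule_step:
  assumes C: "\<And>\<chi>. \<chi> \<in> C \<Longrightarrow> formula L \<chi> \<and> components \<chi> \<subseteq> C"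
    and B: "graded C M B d"
    and x: "x \<in> B"
    and rule: "rule L B x alts" "alt \<in> set alts"
    and once: "\<forall>\<alpha> \<phi>. x = Lab \<alpha> (Box \<phi>) \<longrightarrow> x \<notin> D"
    and new: "\<not> set alt \<subseteq> B"
  shows "\<exists>d'. graded C M (B \<union> set alt) d' \<and>
    ((B \<union> set alt, insert x D, d'), (B, D, d)) \<in> steps C M"
  using rule
proof (cases rule: rule_cases_alt)
  case (local \<alpha> \<phi>)
  obtain n where n: "\<phi> \<in> C" "\<forall>i\<in>\<alpha>. d i = n" "n + size \<phi> \<le> M"
    using B x local(1) unfolding graded_def by blast
  have le: "size \<psi> \<le> size \<phi>" "\<psi> \<in> C" if "\<psi> \<in> insert \<phi> (components \<phi>)" for \<psi>
    using that C[OF n(1)] n(1) size_components[of L \<phi>] by (auto intro: less_imp_le)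
  have W: "worlds (set alt) \<subseteq> worlds B"
    using local worlds_Lab[of \<alpha> \<phi> B] x by (fastforce simp: worlds_def)
  have "\<chi> \<in> C \<and> (\<exists>n. (\<forall>i\<in>\<beta>. d i = n) \<and> n + size \<chi> \<le> M)" if "Lab \<beta> \<chi> \<in> set alt" for \<beta> \<chi>
  proof -
    have "\<beta> \<subseteq> \<alpha>" "\<chi> \<in> insert \<phi> (components \<phi>)"
      using local(2)[OF that] by auto
    then show ?thesis
      using le[of \<chi>] n by (intro conjI exI[of _ n]) auto
  qed
  moreover have "Acc i j \<notin> set alt" for i j
    using local(2) by blast
  ultimately have "graded C M (B \<union> set alt) d"
    using B W unfolding graded_def worlds_Un by (auto simp: sup_absorb1)
  then show ?thesis
    using B new W by (intro exI[of _ d]) (auto simp: steps_def worlds_Un)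
next
  case (dia \<alpha> \<psi> \<beta>)
  obtain n where n: "Dia \<psi> \<in> C" "\<forall>i\<in>\<alpha>. d i = n" "n + size (Dia \<psi>) \<le> M"
    using B x dia(1) unfolding graded_def by blast
  have "\<forall>j\<in>\<beta>. d j = Suc n"
    using dia(3) n(2) B unfolding graded_def by metis
  moreover have W: "worlds (set alt) \<subseteq> worlds B"
    using dia(2,3) worlds_Acc by (fastforce simp: worlds_def)
  moreover have "Suc n + size \<psi> \<le> M" "\<psi> \<in> C"
    using n C[OF n(1)] by auto
  ultimately have "graded C M (B \<union> set alt) d"
    using B unfolding graded_def worlds_Un dia(2)
    by (auto simp: sup_absorb1)
  then show ?thesis
    using B new W by (intro exI[of _ d]) (auto simp: steps_def worlds_Un)
next
  case (box \<alpha> \<psi> f js)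
  obtain n where n: "Box \<psi> \<in> C" "\<forall>i\<in>\<alpha>. d i = n" "n + size (Box \<psi>) \<le> M"
    using B x box(1) unfolding graded_def by blast
  have \<alpha>: "\<alpha> \<subseteq> worlds B"
    using worlds_Lab x box(1) by blast
  have fresh: "set js \<inter> worlds B = {}"
    using box(5) by (simp add: worlds_def)
  have Acc: "i \<in> \<alpha> \<and> j \<in> set js" if "Acc i j \<in> set alt" for i j
    using that box(2,4) by (auto dest: set_zip_leftD set_zip_rightD)
  have W: "worlds (B \<union> set alt) = worlds B \<union> set js"
    using box(2,4) \<alpha> by (fastforce simp: worlds_def dest: set_zip_leftD set_zip_rightD)
  \<comment> \<open>The label has depth n, so its fresh successors get n + 1; freshness keeps old
    depths from being overwritten.\<close>
  define d' where "d' = (\<lambda>i. if i \<in> set js then Suc n else d i)"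
  have d': "d' i = d i" if "i \<in> worlds B" for i
    using that fresh by (auto simp: d'_def)
  have js: "d' j = Suc n" if "j \<in> set js" for j
    using that by (simp add: d'_def)
  have \<psi>: "Suc n + size \<psi> \<le> M" "\<psi> \<in> C"
    using n C[OF n(1)] by auto
  have gB: "graded C M B d'"
    unfolding graded_def
  proof (intro conjI allI impI ballI)
    fix \<beta> \<chi> assume "Lab \<beta> \<chi> \<in> B"
    then show "\<chi> \<in> C" "\<exists>n. (\<forall>i\<in>\<beta>. d' i = n) \<and> n + size \<chi> \<le> M"
      using B d' worlds_Lab[of \<beta> \<chi> B] unfolding graded_def by (blast, metis subsetD)
  next
    fix i j assume "Acc i j \<in> B"
    then show "d' j = Suc (d' i)"
      using B d' worlds_Acc unfolding graded_def by metis
  qed (use B d' in \<open>auto simp: graded_def\<close>)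
  have "graded C M (B \<union> set alt) d'"
    unfolding graded_def W
  proof (intro conjI allI impI ballI)
    fix \<beta> \<chi> assume "Lab \<beta> \<chi> \<in> B \<union> set alt"
    moreover have "\<beta> = set js \<and> \<chi> = \<psi>" if "Lab \<beta> \<chi> \<in> set alt"
      using that box(2) by auto
    ultimately show "\<chi> \<in> C" "\<exists>n. (\<forall>i\<in>\<beta>. d' i = n) \<and> n + size \<chi> \<le> M"
      using gB \<psi> js unfolding graded_def by (blast, metis Un_iff)
  next
    fix i j assume "Acc i j \<in> B \<union> set alt"
    then show "d' j = Suc (d' i)"
      using gB Acc \<alpha> d' js n(2) unfolding graded_def by (metis Un_iff subsetD)
  qed (use gB \<psi> js in \<open>auto simp: graded_def\<close>)
  moreover have "((B \<union> set alt, insert x D, d'), (B, D, d)) \<in> steps C M"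
  proof -
    \<comment> \<open>All of \<alpha> has depth n, so any entry of \<open>f\<close> is a witness;
      there is one, as \<open>f\<close> is as long as \<open>js\<close>, which contains j.\<close>
    have "\<exists>i\<in>\<alpha>. d' j = Suc (d i)" if "j \<in> worlds (B \<union> set alt) - worlds B" for j
    proof -
      from that have "j \<in> set js" using W by blast
      moreover from this have "f \<noteq> []" using box(3) by auto
      then obtain i where "i \<in> \<alpha>" using box(4) by (cases f) auto
      ultimately show ?thesis using js n(2) by auto
    qed
    then have "\<exists>\<alpha> \<phi>. Lab \<alpha> (Box \<phi>) \<in> B \<and> Lab \<alpha> (Box \<phi>) \<in> insert x D - D \<and>
         (\<forall>j\<in>worlds (B \<union> set alt) - worlds B. \<exists>i\<in>\<alpha>. d' j = Suc (d i))"
      using once x box(1) by blast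
    then show ?thesis
      using B new d' unfolding steps_def by auto
  qed
  ultimately show ?thesis by blast
qed

section \<open>Termination\<close>

text \<open>Infinite chains stand for infinite branches. Stated as well-foundedness, the result
  serves as an induction principle and replaces an appeal to Koenig's lemma.\<close>

lemma wf_steps:
  assumes "finite C"
  shows "wf (steps C M)"
proof (rule ccontr)
  assume "\<not> wf (steps C M)"
  then obtain s where "\<forall>k. (s (Suc k), s k) \<in> steps C M"
    unfolding wf_iff_no_infinite_down_chain by blast
  moreover define B where "B k = fst (s k)" for k
  moreover define D where "D k = fst (snd (s k))" for k
  moreover define d where "d k = snd (snd (s k))" for k
  ultimately have steps: "((B (Suc k), D (Suc k), d (Suc k)), (B k, D k, d k)) \<in> steps C M" for k
    by simp
  define W where "W k = worlds (B k)" for k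
  have graded: "graded C M (B k) (d k)" for k
    using steps[of k] by (simp add: steps_def)
  have sub: "B k \<subset> B (Suc k)" for k
    using steps[of k] by (simp add: steps_def)
  have enter: "W (Suc k) \<subseteq> W k \<or>
      (\<exists>\<alpha> \<phi>. Lab \<alpha> (Box \<phi>) \<in> B k \<and> Lab \<alpha> (Box \<phi>) \<in> D (Suc k) - D k \<and>
         (\<forall>j\<in>W (Suc k) - W k. \<exists>i\<in>\<alpha>. d (Suc k) j = Suc (d k i)))" for k
    using steps[of k] unfolding steps_def mem_Collect_eq prod.case W_def by (elim conjE)
  have "D k \<subseteq> D (Suc k)" for k
    using steps[of k] by (simp add: steps_def)
  then have D_mono: "D k \<subseteq> D l" if "k \<le> l" for k l
    using that by (rule lift_Suc_mono_le)
  have "W k \<subseteq> W (Suc k)" for k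
    unfolding W_def using sub[of k] by (intro worlds_mono) blast
  then have W_mono: "W k \<subseteq> W l" if "k \<le> l" for k l
    using that by (rule lift_Suc_mono_le)
  have finW: "finite (W k)" for k
    using graded[of k] by (simp add: graded_def W_def)
  have d_stable: "d l i = d k i" if "k \<le> l" "i \<in> W k" for k l i
    using that(1)
  proof (induction l rule: dec_induct)
    case (step l)
    have "i \<in> W l" using W_mono[OF step(1)] that(2) by blast
    then show ?case
      using step(3) steps[of l] by (simp add: steps_def W_def)
  qed simp
  \<comment> \<open>Depths are stable once a number has entered, so its value at the first stage
    agrees with every later \<open>d k\<close>.\<close>
  define depth where "depth i = d (LEAST k. i \<in> W k) i" for i
  have depth: "depth i = d k i" if "i \<in> W k" for i k
    unfolding depth_def using that by (metis d_stable LeastI Least_le)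
  define level where "level n = {i \<in> \<Union>k. W k. depth i = n}" for n
  \<comment> \<open>A number entering at step k is due to a box formula first used there, whose
    label lies exactly one level above; so its depth is positive.\<close>
  have new: "\<exists>\<alpha> \<phi>. Lab \<alpha> (Box \<phi>) \<in> D (Suc k) - D k \<and> Box \<phi> \<in> C \<and>
      (\<exists>m. n = Suc m \<and> \<alpha> \<subseteq> level m)"
    if j: "j \<in> W (Suc k) - W k" "depth j = n" for j k n
  proof -
    obtain \<alpha> \<phi> where \<alpha>: "Lab \<alpha> (Box \<phi>) \<in> B k" "Lab \<alpha> (Box \<phi>) \<in> D (Suc k) - D k"
      "\<forall>j\<in>W (Suc k) - W k. \<exists>i\<in>\<alpha>. d (Suc k) j = Suc (d k i)"
      using enter[of k] j(1) by blast
    then obtain i where i: "i \<in> \<alpha>" "d (Suc k) j = Suc (d k i)"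
      using j(1) by blast
    have \<alpha>W: "\<alpha> \<subseteq> W k"
      using worlds_Lab[OF \<alpha>(1)] unfolding W_def .
    obtain m where m: "\<forall>i\<in>\<alpha>. d k i = m" and C: "Box \<phi> \<in> C"
      using graded[of k] \<alpha>(1) unfolding graded_def by blast
    have "n = Suc m"
      using depth[of j "Suc k"] j i m by simp
    moreover have "\<alpha> \<subseteq> level m"
      unfolding level_def using \<alpha>W m depth by fastforce
    ultimately show ?thesis
      using \<alpha>(2) C by blast
  qed
  have first: "\<exists>k. j \<in> W (Suc k) - W k" if "j \<in> W l" "j \<notin> W 0" for j l
    using that by (induction l) auto
  have fin_level: "finite (level n)" for n
  proof (induction n)
    case 0
    \<comment> \<open>Newcomers have positive depth, so numbers of depth 0 are present from the
      start.\<close>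
    have "level 0 \<subseteq> W 0"
      using first new unfolding level_def by blast
    then show ?case using finW finite_subset by blast
  next
    case (Suc m)
    \<comment> \<open>The only steps that can introduce numbers of depth m + 1. There are finitely
      many: sending each to a box formula it first uses is injective into a finite set.\<close>
    define K where "K = {k. \<exists>\<alpha> \<phi>. Lab \<alpha> (Box \<phi>) \<in> D (Suc k) - D k \<and> Box \<phi> \<in> C \<and> \<alpha> \<subseteq> level m}"
    then have "\<forall>k\<in>K. \<exists>\<alpha> \<phi>. Lab \<alpha> \<phi> \<in> D (Suc k) - D k \<and> \<phi> \<in> C \<and> \<alpha> \<subseteq> level m"
      by blast
    then obtain a p where ap: "\<And>k. k \<in> K \<Longrightarrow>
        Lab (a k) (p k) \<in> D (Suc k) - D k \<and> p k \<in> C \<and> a k \<subseteq> level m"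
      unfolding bchoice_iff by blast
    \<comment> \<open>The formula chosen for k is in \<open>D (Suc k)\<close>, hence in
      \<open>D l\<close>; the one chosen for l is not in \<open>D l\<close>.\<close>
    have "(a k, p k) \<noteq> (a l, p l)" if "k \<in> K" "l \<in> K" "k < l" for k l
      using ap[OF that(1)] ap[OF that(2)] D_mono[of "Suc k" l] that(3) by auto
    then have "inj_on (\<lambda>k. (a k, p k)) K"
      by (intro inj_onI) (metis nat_neq_iff)
    moreover have "(\<lambda>k. (a k, p k)) ` K \<subseteq> Pow (level m) \<times> C"
      using ap by auto
    ultimately have "finite K"
      using Suc assms by (meson finite_Pow_iff finite_SigmaI inj_on_finite)
    moreover have "level (Suc m) \<subseteq> W 0 \<union> (\<Union>k\<in>K. W (Suc k))"
    proof
      fix j assume j: "j \<in> level (Suc m)"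
      show "j \<in> W 0 \<union> (\<Union>k\<in>K. W (Suc k))"
      proof (cases "j \<in> W 0")
        case False
        then obtain k where k: "j \<in> W (Suc k) - W k"
          using first j unfolding level_def by blast
        have "k \<in> K"
          using new[OF k, of "Suc m"] j unfolding level_def K_def by blast
        then show ?thesis using k by blast
      qed simp
    qed
    ultimately show ?case
      using finW by (meson finite_UN finite_Un finite_subset)
  qed
  \<comment> \<open>Depths are at most \<open>M\<close>, so finitely many finite levels cover all
    numbers of the branch.\<close>
  define V where "V = (\<Union>n\<le>M. level n)"
  have WV: "W k \<subseteq> V" for k
  proof
    fix i assume i: "i \<in> W k"
    then have "d k i \<le> M" using graded[of k] unfolding graded_def W_def by blast
    then show "i \<in> V" using depth[OF i] i unfolding V_def level_def by auto
  qed
  define F where "F = case_prod Lab ` (Pow V \<times> C) \<union> case_prod Acc ` (V \<times> V)"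
  have "finite F"
    using fin_level assms unfolding F_def V_def by auto
  have "B k \<subseteq> F" for k
  proof
    fix y assume y: "y \<in> B k"
    show "y \<in> F"
    proof (cases y)
      case (Lab \<alpha> \<chi>)
      then have "\<chi> \<in> C" "\<alpha> \<subseteq> V"
        using y graded[of k] worlds_Lab[of \<alpha> \<chi> "B k"] WV[of k]
        unfolding graded_def W_def by blast+
      then show ?thesis unfolding F_def Lab by auto
    next
      case (Acc i j)
      then have "i \<in> V" "j \<in> V"
        using y worlds_Acc[of i j "B k"] WV[of k] unfolding W_def by blast+
      then show ?thesis unfolding F_def Acc by auto
    qed
  qed
  \<comment> \<open>A strictly increasing sequence has no room among the subsets of the finite set
    \<open>F\<close>.\<close>
  then have "finite (range B)"
    using \<open>finite F\<close> by (intro finite_subset[of "range B" "Pow F"]) auto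
  moreover have "inj B"
    using lift_Suc_mono_less[of B] sub by (intro linorder_injI) blast
  ultimately show False
    using finite_imageD by blast
qed

section \<open>Finiteness of trees and of expansions\<close>

lemma finite_tree_iff: "finite_tree t \<longleftrightarrow> (\<forall>u\<in>set (children t). finite_tree u)"
proof -
  have eq: "{\<pi>. is_node t \<pi>} =
      insert [] (\<Union>k<length (children t). (#) k ` {\<pi>. is_node (children t ! k) \<pi>})"
  proof (intro set_eqI)
    fix \<pi>
    show "\<pi> \<in> {\<pi>. is_node t \<pi>} \<longleftrightarrow>
      \<pi> \<in> insert [] (\<Union>k<length (children t). (#) k ` {\<pi>. is_node (children t ! k) \<pi>})"
      by (cases \<pi>) auto
  qed
  show ?thesis
    unfolding finite_tree_def eq by (auto simp: all_set_conv_all_nth finite_image_iff)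
qed

lemma finite_tree_chain:
  "\<forall>u\<in>set ts. finite_tree u \<Longrightarrow> \<forall>u\<in>set (chain xs ts). finite_tree u"
  by (induction xs) (simp_all add: finite_tree_iff[of "Node _ _"])

text \<open>Induction along \<open>steps\<close>: each of the finitely many alternatives leads to a
  smaller state, and \<open>chain\<close> puts only finitely many nodes above the trees obtained
  there.\<close>

lemma finite_expansion:
  assumes C: "finite C" "\<And>\<chi>. \<chi> \<in> C \<Longrightarrow> formula L \<chi> \<and> components \<chi> \<subseteq> C"
  shows "graded C M B d \<Longrightarrow> expansion L B D ts \<Longrightarrow> \<forall>u\<in>set ts. finite_tree u"
proof (induction "(B, D, d)" arbitrary: B D d ts rule: wf_induct_rule[OF wf_steps[OF C(1), of M]])
  case less: 1
  from less.prems(2) show ?case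
  proof cases
    case (extend x alts tss)
    have IH: "\<forall>u\<in>set ts'. finite_tree u"
      if "alt \<in> set alts" "expansion L (B \<union> set alt) (insert x D) ts'" for alt ts'
    proof -
      \<comment> \<open>That every alternative adds an item makes the inclusion in
        \<open>steps\<close> strict.\<close>
      have "new_items B alt \<noteq> []" using extend that(1) by blast
      then have "\<not> set alt \<subseteq> B" by (auto simp: new_items_def filter_empty_conv)
      with C(2) less.prems(1) extend(2,3) that(1) extend(4)
      have "\<exists>d'. graded C M (B \<union> set alt) d' \<and>
        ((B \<union> set alt, insert x D, d'), (B, D, d)) \<in> steps C M"
        by (rule rule_step)
      then show ?thesis using less.hyps that(2) by metis
    qed
    show ?thesis
    proof
      fix u assume "u \<in> set ts"
      then obtain alt ts' where *: "(alt, ts') \<in> set (zip alts tss)"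
        "u \<in> set (chain (new_items B alt) ts')"
        using extend(1) by auto
      then have "alt \<in> set alts" "expansion L (B \<union> set alt) (insert x D) ts'"
        using extend by (auto simp: list_all2_iff dest: set_zip_leftD)
      then show "finite_tree u" using IH finite_tree_chain *(2) by blast
    qed
  qed simp
qed

theorem theorem7:
  fixes L :: logic and \<phi> :: "'p fm" and t :: "'p item tree"
  assumes "formula L \<phi>"
    and "tableau L \<phi> t"
  shows "finite_tree t"
proof -
  obtain C where C: "finite C" "\<phi> \<in> C" "\<And>\<chi>. \<chi> \<in> C \<Longrightarrow> formula L \<chi> \<and> components \<chi> \<subseteq> C"
    using finite_component_closure[OF assms(1)] by blast
  have t: "root t = Lab {1..2 ^ vrank \<phi>} \<phi>" "expansion L {root t} {} (children t)"
    using assms(2) by (auto simp: tableau_def)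
  \<comment> \<open>Root numbers have depth 0, so the size of the root formula is the whole depth
    budget.\<close>
  have "graded C (size \<phi>) {root t} (\<lambda>_. 0)"
    using C(2) unfolding graded_def t(1) worlds_def by auto
  then show ?thesis
    using finite_expansion[OF C(1,3)] t(2) finite_tree_iff by blast
qed

end
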